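(* Let $J$ be a conjugation in the complex separable Hilbert space $\mathcal{H}$ and let $\mathbf{C}$ be a conjugation in $L^2(\mathcal{H})$ such that $\mathbf{C}\mathbf{M}_z=\mathbf{M}_z\mathbf{C}$. If $\mathbf{C}(H^2(\mathcal{H}))\subset H^2(\mathcal{H})$, then there is a unitary $J$-symmetric operator $U_0\in L(\mathcal{H})$ such that $\mathbf{C}=M_{\mathbf{U}}\mathbf{J}^{\star}=\mathbf{J}^{\star}M_{\mathbf{U}^*}$, where $\mathbf{U}$ is the constant operator valued function $\mathbf{U}(z)=U_0$ for almost all $z\in\mathbb{T}$.
   Context: $\mathbb{T}$ is the unit circle with normalized Lebesgue measure $m$; $L(\mathcal{H})$ is the algebra of bounded linear operators on $\mathcal{H}$. A conjugation on a Hilbert space $\mathcal{K}$ is an antilinear map $C:\mathcal{K}\to\mathcal{K}$ with $C^2=I$ and $\langle Cf,Cg\rangle=\langle g,f\rangle$ for all $f,g$. A bounded linear operator $A$ is $C$-symmetric if $CAC=A^*$. $L^2(\mathcal{H})$ is the Hilbert space of (classes of) measurable square-integrable $\mathbf{f}:\mathbb{T}\to\mathcal{H}$ with inner product $\int_{\mathbb{T}}\langle\mathbf{f}(z),\mathbf{g}(z)\rangle dm(z)$; every $\mathbf{f}\in L^2(\mathcal{H})$ has a Fourier expansion $\mathbf{f}=\sum_{n\in\mathbb{Z}}x_ne_n$ with $x_n\in\mathcal{H}$, $e_n(z)=z^n$, and $H^2(\mathcal{H})$ is the closed subspace of those $\mathbf{f}$ with $x_n=0$ for $n<0$. $(\mathbf{M}_z\mathbf{f})(z)=z\mathbf{f}(z)$.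 For an essentially bounded measurable $\mathbf{F}:\mathbb{T}\to L(\mathcal{H})$, $(M_{\mathbf{F}}\mathbf{f})(z)=\mathbf{F}(z)\mathbf{f}(z)$ and $\mathbf{F}^*(z)=\mathbf{F}(z)^*$ a.e. For a conjugation $J$ in $\mathcal{H}$, $\mathbf{J}^\star$ is the conjugation on $L^2(\mathcal{H})$ given by $(\mathbf{J}^\star\mathbf{f})(z)=J(\mathbf{f}(\bar z))$ a.e. *)

theory Defs
  imports "HOL-Analysis.Analysis"
begin

section \<open>Complex Hilbert spaces\<close>

text \<open>
  A complex inner product space is presented on top of \<^class>\<open>real_inner\<close>: the real inner product
  is the real part of the complex one, so that \<open>norm x = sqrt (Re (cinner x x))\<close>. The complex inner
  product is linear in the first and antilinear in the second argument.
\<close>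

class complex_inner = real_inner +
  fixes scaleC :: "complex \<Rightarrow> 'a \<Rightarrow> 'a" (infixr \<open>*\<^sub>C\<close> 75)
    and cinner :: "'a \<Rightarrow> 'a \<Rightarrow> complex"
  assumes scaleC_add_right: "a *\<^sub>C (x + y) = a *\<^sub>C x + a *\<^sub>C y"
    and scaleC_add_left: "(a + b) *\<^sub>C x = a *\<^sub>C x + b *\<^sub>C x"
    and scaleC_scaleC: "a *\<^sub>C b *\<^sub>C x = (a * b) *\<^sub>C x"
    and scaleR_scaleC: "r *\<^sub>R x = complex_of_real r *\<^sub>C x"
    and cinner_commute: "cinner x y = cnj (cinner y x)"
    and cinner_add_left: "cinner (x + y) z = cinner x z + cinner y z"
    and cinner_scaleC_left: "cinner (a *\<^sub>C x) y = a * cinner x y"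
    and inner_eq_Re_cinner: "inner x y = Re (cinner x y)"

class chilbert_space = complex_inner + banach

lemma scaleC_one: "1 *\<^sub>C (x :: 'a::complex_inner) = x"
  using scaleR_scaleC[of 1 x] by simp

lemma scaleC_zero: "c *\<^sub>C (0 :: 'a::complex_inner) = 0"
  using scaleC_add_right[of c 0 0] by simp

lemma scaleC_decompose: "c *\<^sub>C (x :: 'a::complex_inner) = Re c *\<^sub>R x + Im c *\<^sub>R (\<i> *\<^sub>C x)"
proof -
  have "c = complex_of_real (Re c) + complex_of_real (Im c) * \<i>"
    by (simp add: complex_eq mult.commute)
  then have "c *\<^sub>C x = (complex_of_real (Re c) + complex_of_real (Im c) * \<i>) *\<^sub>C x"
    by simp
  then show ?thesis
    by (simp only: scaleC_add_left scaleR_scaleC scaleC_scaleC)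
qed

lemma cinner_scaleC_right: "cinner x (a *\<^sub>C y) = cnj a * cinner x (y :: 'a::complex_inner)"
  by (metis cinner_commute cinner_scaleC_left complex_cnj_mult)

lemma norm_scaleC: "norm (c *\<^sub>C (x :: 'a::complex_inner)) = cmod c * norm x"
proof -
  have "cinner (c *\<^sub>C x) (c *\<^sub>C x) = complex_of_real ((cmod c)\<^sup>2) * cinner x x"
    by (simp add: cinner_scaleC_left cinner_scaleC_right complex_norm_square ac_simps del: of_real_power)
  then have "(norm (c *\<^sub>C x))\<^sup>2 = (cmod c * norm x)\<^sup>2"
    by (simp add: power2_norm_eq_inner inner_eq_Re_cinner power_mult_distrib)
  then show ?thesis
    by (simp add: power2_eq_iff_nonneg)
qed

lemma bounded_linear_scaleC: "bounded_linear (\<lambda>x :: 'a::complex_inner. c *\<^sub>C x)"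
proof (rule bounded_linear_intro[where K = "cmod c"])
  fix x y :: 'a and r :: real
  show "c *\<^sub>C (x + y) = c *\<^sub>C x + c *\<^sub>C y"
    by (rule scaleC_add_right)
  show "c *\<^sub>C (r *\<^sub>R x) = r *\<^sub>R (c *\<^sub>C x)"
    by (simp add: scaleR_scaleC scaleC_scaleC mult.commute)
  show "norm (c *\<^sub>C x) \<le> norm x * cmod c"
    by (simp add: norm_scaleC mult.commute)
qed

lemma cinner_decompose:
  "cinner x y = complex_of_real (inner x y) + \<i> * complex_of_real (inner ((- \<i>) *\<^sub>C x) (y :: 'a::complex_inner))"
  by (simp add: inner_eq_Re_cinner cinner_scaleC_left complex_eq_iff)

lemma cmod_cinner_le: "cmod (cinner x y) \<le> norm x * norm (y :: 'a::complex_inner)"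
proof (cases "cinner x y = 0")
  case False
  define c where "c = cnj (cinner x y) / cmod (cinner x y)"
  have c: "cmod c = 1" "c * cinner x y = cmod (cinner x y)"
    using False by (auto simp: c_def norm_divide complex_norm_square[symmetric] mult.commute
        power2_eq_square divide_simps)
  have "cmod (cinner x y) = inner (c *\<^sub>C x) y"
    using c by (simp add: inner_eq_Re_cinner cinner_scaleC_left)
  also have "\<dots> \<le> norm (c *\<^sub>C x) * norm y"
    by (rule norm_cauchy_schwarz)
  finally show ?thesis
    using c by (simp add: norm_scaleC)
qed simp

subsection \<open>Conjugations and bounded operators\<close>

definition conjugation :: "('a::complex_inner \<Rightarrow> 'a) \<Rightarrow> bool" where
  "conjugation C \<longleftrightarrow>
     (\<forall>x y. C (x + y) = C x + C y) \<and> (\<forall>a x. C (a *\<^sub>C x) = cnj a *\<^sub>C C x) \<and>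
     (\<forall>x. C (C x) = x) \<and> (\<forall>x y. cinner (C x) (C y) = cinner y x)"

text \<open>The algebra \<open>L(H)\<close> is the set of all functions on \<open>H\<close> that satisfy the following predicate.\<close>

definition bounded_clinear :: "('a::complex_inner \<Rightarrow> 'b::complex_inner) \<Rightarrow> bool" where
  "bounded_clinear A \<longleftrightarrow> bounded_linear A \<and> (\<forall>a x. A (a *\<^sub>C x) = a *\<^sub>C A x)"

text \<open>As for \<^const>\<open>adjoint\<close>, the choice is unique when it exists, and on a Hilbert space it exists for
  every bounded operator.\<close>

definition cadjoint :: "('a::complex_inner \<Rightarrow> 'b::complex_inner) \<Rightarrow> 'b \<Rightarrow> 'a" where
  "cadjoint A = (SOME B. \<forall>x y. cinner (A x) y = cinner x (B y))"

definition unitary_op :: "('a::complex_inner \<Rightarrow> 'a) \<Rightarrow> bool" where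
  "unitary_op U \<longleftrightarrow> bounded_clinear U \<and> cadjoint U \<circ> U = id \<and> U \<circ> cadjoint U = id"

definition C_symmetric :: "('a::complex_inner \<Rightarrow> 'a) \<Rightarrow> ('a \<Rightarrow> 'a) \<Rightarrow> bool" where
  "C_symmetric C A \<longleftrightarrow> bounded_clinear A \<and> C \<circ> A \<circ> C = cadjoint A"


section \<open>The space of square-integrable functions on the unit circle\<close>

text \<open>Normalized Lebesgue (arc length) measure; its space is the unit circle \<^term>\<open>sphere (0::complex) 1\<close>,
  so that values of functions off the circle play no role.\<close>

definition circle_measure :: "complex measure" where
  "circle_measure =
     distr (uniform_measure lborel {0..1}) (restrict_space borel (sphere 0 1)) (\<lambda>t. cis (2 * pi * t))"

definition square_integrable :: "(complex \<Rightarrow> 'h::complex_inner) \<Rightarrow> bool" where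
  "square_integrable f \<longleftrightarrow>
     f \<in> borel_measurable circle_measure \<and> integrable circle_measure (\<lambda>z. (norm (f z))\<^sup>2)"

definition L2_rel :: "(complex \<Rightarrow> 'h::complex_inner) \<Rightarrow> (complex \<Rightarrow> 'h) \<Rightarrow> bool" where
  "L2_rel f g \<longleftrightarrow> square_integrable f \<and> square_integrable g \<and> (AE z in circle_measure. f z = g z)"

lemma square_integrable_zero: "square_integrable (\<lambda>z. 0)"
  by (simp add: square_integrable_def)

text \<open>For a separable space (in type class terms: \<^class>\<open>second_countable_topology\<close>) the various notions
  of measurability of vector-valued functions agree with Borel measurability.\<close>

quotient_type (overloaded) 'h L2 =
  "complex \<Rightarrow> 'h::{complex_inner,second_countable_topology}" / partial: L2_rel
  morphisms rep_L2 abs_L2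
proof (rule part_equivpI)
  show "\<exists>f :: complex \<Rightarrow> 'h. L2_rel f f"
    using square_integrable_zero by (auto simp: L2_rel_def)
  show "symp (L2_rel :: (complex \<Rightarrow> 'h) \<Rightarrow> _)"
    by (auto simp: symp_def L2_rel_def elim: eventually_mono)
  show "transp (L2_rel :: (complex \<Rightarrow> 'h) \<Rightarrow> _)"
    unfolding transp_def L2_rel_def by (auto elim: eventually_elim2)
qed

lemma L2_rel_refl_iff: "L2_rel f f \<longleftrightarrow> square_integrable f"
  by (simp add: L2_rel_def)

lemma square_integrable_rep_L2: "square_integrable (rep_L2 f)"
  using Quotient_rep_reflp[OF Quotient_L2, of f] by (simp add: L2_rel_refl_iff)

lemma rep_abs_L2:
  "square_integrable f \<Longrightarrow> AE z in circle_measure. rep_L2 (abs_L2 f) z = f z"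
  using Quotient_rep_abs[OF Quotient_L2, of f] by (simp add: L2_rel_def)

lemma square_integrable_add:
  fixes f g :: "complex \<Rightarrow> 'h::{complex_inner,second_countable_topology}"
  assumes "square_integrable f" "square_integrable g"
  shows "square_integrable (\<lambda>z. f z + g z)"
  unfolding square_integrable_def
proof
  have [measurable]: "f \<in> borel_measurable circle_measure" "g \<in> borel_measurable circle_measure"
    using assms by (auto simp: square_integrable_def)
  show "(\<lambda>z. f z + g z) \<in> borel_measurable circle_measure"
    by measurable
  have "integrable circle_measure (\<lambda>z. 2 * (norm (f z))\<^sup>2 + 2 * (norm (g z))\<^sup>2)"
    using assms by (auto simp: square_integrable_def)
  then show "integrable circle_measure (\<lambda>z. (norm (f z + g z))\<^sup>2)"
  proof (rule Bochner_Integration.integrable_bound)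
    have "(norm (a + b))\<^sup>2 \<le> 2 * (norm a)\<^sup>2 + 2 * (norm b)\<^sup>2" for a b :: 'h
    proof -
      have "(norm (a + b))\<^sup>2 \<le> (norm a + norm b)\<^sup>2"
        by (simp add: norm_triangle_ineq power_mono)
      also have "\<dots> \<le> 2 * (norm a)\<^sup>2 + 2 * (norm b)\<^sup>2"
        using sum_squares_bound[of "norm a" "norm b"] by (simp add: power2_sum)
      finally show ?thesis .
    qed
    then show "AE z in circle_measure. norm ((norm (f z + g z))\<^sup>2)
        \<le> norm (2 * (norm (f z))\<^sup>2 + 2 * (norm (g z))\<^sup>2)"
      by simp
  qed measurable
qed

lemma borel_measurable_scaleC:
  fixes f :: "'b \<Rightarrow> 'h::{complex_inner,second_countable_topology}"
  assumes [measurable]: "c \<in> borel_measurable M" "f \<in> borel_measurable M"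
  shows "(\<lambda>z. c z *\<^sub>C f z) \<in> borel_measurable M"
proof -
  have [measurable]: "(\<lambda>x::'h. \<i> *\<^sub>C x) \<in> borel_measurable borel"
    by (intro borel_measurable_continuous_onI linear_continuous_on bounded_linear_scaleC)
  show ?thesis
    by (subst scaleC_decompose) measurable
qed

lemma square_integrable_scaleC:
  fixes f :: "complex \<Rightarrow> 'h::{complex_inner,second_countable_topology}"
  assumes "square_integrable f"
  shows "square_integrable (\<lambda>z. c *\<^sub>C f z)"
  using assms by (auto simp: square_integrable_def norm_scaleC power_mult_distrib
      intro: borel_measurable_scaleC)

lemma square_integrable_scaleR:
  fixes f :: "complex \<Rightarrow> 'h::{complex_inner,second_countable_topology}"
  assumes "square_integrable f"
  shows "square_integrable (\<lambda>z. r *\<^sub>R f z)"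
  using square_integrable_scaleC[OF assms] by (simp add: scaleR_scaleC)

lemma square_integrable_uminus:
  fixes f :: "complex \<Rightarrow> 'h::{complex_inner,second_countable_topology}"
  assumes "square_integrable f"
  shows "square_integrable (\<lambda>z. - f z)"
  using square_integrable_scaleR[OF assms, of "-1"] by simp

lemma square_integrable_diff:
  fixes f g :: "complex \<Rightarrow> 'h::{complex_inner,second_countable_topology}"
  assumes "square_integrable f" "square_integrable g"
  shows "square_integrable (\<lambda>z. f z - g z)"
  using square_integrable_add[OF assms(1) square_integrable_uminus[OF assms(2)]] by simp

lemma borel_measurable_cinner:
  fixes f g :: "'b \<Rightarrow> 'h::{complex_inner,second_countable_topology}"
  assumes [measurable]: "f \<in> borel_measurable M" "g \<in> borel_measurable M"
  shows "(\<lambda>z. cinner (f z) (g z)) \<in> borel_measurable M"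
proof -
  have [measurable]: "(\<lambda>z. (- \<i>) *\<^sub>C f z) \<in> borel_measurable M"
    by (intro borel_measurable_scaleC) auto
  show ?thesis
    unfolding cinner_decompose by measurable
qed

lemma integrable_cinner:
  fixes f g :: "complex \<Rightarrow> 'h::{complex_inner,second_countable_topology}"
  assumes "square_integrable f" "square_integrable g"
  shows "integrable circle_measure (\<lambda>z. cinner (f z) (g z))"
proof (rule Bochner_Integration.integrable_bound)
  show "integrable circle_measure (\<lambda>z. (norm (f z))\<^sup>2 + (norm (g z))\<^sup>2)"
    using assms by (auto simp: square_integrable_def)
  show "(\<lambda>z. cinner (f z) (g z)) \<in> borel_measurable circle_measure"
    using assms by (auto simp: square_integrable_def intro: borel_measurable_cinner)
  have "cmod (cinner a b) \<le> (norm a)\<^sup>2 + (norm b)\<^sup>2" for a b :: 'h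
  proof -
    have "cmod (cinner a b) \<le> norm a * norm b"
      by (rule cmod_cinner_le)
    also have "\<dots> \<le> 2 * norm a * norm b"
      by simp
    also have "\<dots> \<le> (norm a)\<^sup>2 + (norm b)\<^sup>2"
      by (rule sum_squares_bound)
    finally show ?thesis .
  qed
  then show "AE z in circle_measure. norm (cinner (f z) (g z)) \<le> norm ((norm (f z))\<^sup>2 + (norm (g z))\<^sup>2)"
    by simp
qed

instantiation L2 :: ("{complex_inner,second_countable_topology}") complex_inner
begin

lift_definition zero_L2 :: "'a L2" is "\<lambda>z. 0"
  by (simp add: L2_rel_def square_integrable_zero)

lift_definition plus_L2 :: "'a L2 \<Rightarrow> 'a L2 \<Rightarrow> 'a L2" is "\<lambda>f g z. f z + g z"
  by (auto simp: L2_rel_def square_integrable_add)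

lift_definition uminus_L2 :: "'a L2 \<Rightarrow> 'a L2" is "\<lambda>f z. - f z"
  by (auto simp: L2_rel_def square_integrable_uminus)

lift_definition minus_L2 :: "'a L2 \<Rightarrow> 'a L2 \<Rightarrow> 'a L2" is "\<lambda>f g z. f z - g z"
  by (auto simp: L2_rel_def square_integrable_diff)

lift_definition scaleR_L2 :: "real \<Rightarrow> 'a L2 \<Rightarrow> 'a L2" is "\<lambda>r f z. r *\<^sub>R f z"
  by (auto simp: L2_rel_def square_integrable_scaleR)

lift_definition scaleC_L2 :: "complex \<Rightarrow> 'a L2 \<Rightarrow> 'a L2" is "\<lambda>c f z. c *\<^sub>C f z"
  by (auto simp: L2_rel_def square_integrable_scaleC)

lift_definition cinner_L2 :: "'a L2 \<Rightarrow> 'a L2 \<Rightarrow> complex" is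
  "\<lambda>f g. LINT z|circle_measure. cinner (f z) (g z)"
  unfolding L2_rel_def square_integrable_def
  by (intro integral_cong_AE) (auto intro: borel_measurable_cinner)

definition inner_L2 :: "'a L2 \<Rightarrow> 'a L2 \<Rightarrow> real" where
  "inner_L2 f g = Re (cinner f g)"

definition norm_L2 :: "'a L2 \<Rightarrow> real" where
  "norm_L2 f = sqrt (inner f f)"

definition sgn_L2 :: "'a L2 \<Rightarrow> 'a L2" where
  "sgn_L2 f = inverse (norm f) *\<^sub>R f"

definition dist_L2 :: "'a L2 \<Rightarrow> 'a L2 \<Rightarrow> real" where
  "dist_L2 f g = norm (f - g)"

definition uniformity_L2 :: "('a L2 \<times> 'a L2) filter" where
  "uniformity_L2 = (INF e\<in>{0<..}. principal {(f, g). dist f g < e})"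

definition open_L2 :: "'a L2 set \<Rightarrow> bool" where
  "open_L2 S \<longleftrightarrow> (\<forall>f\<in>S. \<forall>\<^sub>F (f', g) in uniformity. f' = f \<longrightarrow> g \<in> S)"

instance
proof
  fix f g h :: "'a L2" and r s :: real and a b :: complex
  show "f + g + h = f + (g + h)"
    by transfer (auto simp: L2_rel_def square_integrable_add add.assoc)
  show "f + g = g + f"
    by transfer (auto simp: L2_rel_def square_integrable_add add.commute)
  show "0 + f = f"
    by transfer (auto simp: L2_rel_def)
  show "- f + f = 0"
    by transfer (auto simp: L2_rel_def square_integrable_zero)
  show "f - g = f + - g"
    by transfer (auto simp: L2_rel_def square_integrable_diff)
  show "r *\<^sub>R (f + g) = r *\<^sub>R f + r *\<^sub>R g"
    by transfer (auto simp: L2_rel_def square_integrable_add square_integrable_scaleR scaleR_add_right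
        intro!: square_integrable_add square_integrable_scaleR)
  show "(r + s) *\<^sub>R f = r *\<^sub>R f + s *\<^sub>R f"
    by transfer (auto simp: L2_rel_def scaleR_add_left
        intro!: square_integrable_add square_integrable_scaleR)
  show "r *\<^sub>R s *\<^sub>R f = (r * s) *\<^sub>R f"
    by transfer (auto simp: L2_rel_def intro!: square_integrable_scaleR)
  show "1 *\<^sub>R f = f"
    by transfer (auto simp: L2_rel_def)
  show "a *\<^sub>C (f + g) = a *\<^sub>C f + a *\<^sub>C g"
    by transfer (auto simp: L2_rel_def scaleC_add_right
        intro!: square_integrable_add square_integrable_scaleC)
  show "(a + b) *\<^sub>C f = a *\<^sub>C f + b *\<^sub>C f"
    by transfer (auto simp: L2_rel_def scaleC_add_left
        intro!: square_integrable_add square_integrable_scaleC)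
  show "a *\<^sub>C b *\<^sub>C f = (a * b) *\<^sub>C f"
    by transfer (auto simp: L2_rel_def scaleC_scaleC intro!: square_integrable_scaleC)
  show "r *\<^sub>R f = complex_of_real r *\<^sub>C f"
    by transfer (auto simp: L2_rel_def scaleR_scaleC intro!: square_integrable_scaleC)
  show commute: "cinner f g = cnj (cinner g f)" for f g :: "'a L2"
  proof transfer
    fix f g :: "complex \<Rightarrow> 'a"
    have "(LINT z|circle_measure. cinner (f z) (g z)) = (LINT z|circle_measure. cnj (cinner (g z) (f z)))"
      by (intro Bochner_Integration.integral_cong refl cinner_commute)
    then show "(LINT z|circle_measure. cinner (f z) (g z)) = cnj (LINT z|circle_measure. cinner (g z) (f z))"
      by simp
  qed
  show add: "cinner (f + g) h = cinner f h + cinner g h" for f g h :: "'a L2"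
    by transfer (simp add: L2_rel_refl_iff cinner_add_left integrable_cinner)
  show scale: "cinner (a *\<^sub>C f) g = a * cinner f g" for a and f g :: "'a L2"
    by transfer (simp add: cinner_scaleC_left)
  show inner: "inner f g = Re (cinner f g)" for f g :: "'a L2"
    by (rule inner_L2_def)
  show "inner f g = inner g f"
    using commute[of f g] by (simp add: inner)
  show "inner (f + g) h = inner f h + inner g h"
    by (simp add: inner add)
  have scaleR: "r *\<^sub>R f = complex_of_real r *\<^sub>C f"
    by transfer (auto simp: L2_rel_def scaleR_scaleC intro!: square_integrable_scaleC)
  show "inner (r *\<^sub>R f) g = r * inner f g"
    by (simp add: inner scaleR scale)
  have self: "inner f f = (LINT z|circle_measure. (norm (rep_L2 f z))\<^sup>2)"
  proof -
    have "cinner f f = (LINT z|circle_measure. cinner (rep_L2 f z) (rep_L2 f z))"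
      by (simp add: cinner_L2.rep_eq)
    then show ?thesis
      by (simp add: inner integral_Re[OF integrable_cinner, symmetric] square_integrable_rep_L2
          power2_norm_eq_inner inner_eq_Re_cinner)
  qed
  show "0 \<le> inner f f"
    by (simp add: self)
  note sq = square_integrable_rep_L2[of f]
  have "inner f f = 0 \<longleftrightarrow> (AE z in circle_measure. (norm (rep_L2 f z))\<^sup>2 = 0)"
    unfolding self using sq
    by (intro integral_nonneg_eq_0_iff_AE) (auto simp: square_integrable_def)
  also have "\<dots> \<longleftrightarrow> L2_rel (rep_L2 f) (\<lambda>z. 0)"
    using sq by (simp add: L2_rel_def square_integrable_zero)
  also have "\<dots> \<longleftrightarrow> f = 0"
    using Quotient_rel[OF Quotient_L2, of "rep_L2 f" "\<lambda>z. 0"] sq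
    by (auto simp: L2_rel_refl_iff square_integrable_zero zero_L2_def Quotient_abs_rep[OF Quotient_L2])
  finally show "inner f f = 0 \<longleftrightarrow> f = 0" .
  show "norm f = sqrt (inner f f)"
    by (rule norm_L2_def)
  show "sgn f = inverse (norm f) *\<^sub>R f"
    by (rule sgn_L2_def)
  show "dist f g = norm (f - g)"
    by (rule dist_L2_def)
  show "uniformity = (INF e\<in>{0<..}. principal {(f :: 'a L2, g). dist f g < e})"
    by (rule uniformity_L2_def)
  show "open S = (\<forall>f\<in>S. \<forall>\<^sub>F (f', g) in uniformity. f' = f \<longrightarrow> g \<in> S)" for S :: "'a L2 set"
    by (rule open_L2_def)
qed

end


subsection \<open>Operators on L2 and the Hardy space\<close>

text \<open>The following operators act on representatives; the lemmas below confirm that they satisfy the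
  intended identities almost everywhere whenever the resulting function is square-integrable.\<close>

definition mult_op :: "(complex \<Rightarrow> 'h \<Rightarrow> 'h) \<Rightarrow> 'h::{complex_inner,second_countable_topology} L2 \<Rightarrow> 'h L2" where
  "mult_op F f = abs_L2 (\<lambda>z. F z (rep_L2 f z))"

definition fun_adjoint :: "(complex \<Rightarrow> 'h \<Rightarrow> 'h::complex_inner) \<Rightarrow> complex \<Rightarrow> 'h \<Rightarrow> 'h" where
  "fun_adjoint F = (\<lambda>z. cadjoint (F z))"

definition M_z :: "'h::{complex_inner,second_countable_topology} L2 \<Rightarrow> 'h L2" where
  "M_z = mult_op (\<lambda>z x. z *\<^sub>C x)"

definition J_star :: "('h \<Rightarrow> 'h) \<Rightarrow> 'h::{complex_inner,second_countable_topology} L2 \<Rightarrow> 'h L2" where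
  "J_star J f = abs_L2 (\<lambda>z. J (rep_L2 f (cnj z)))"

text \<open>The coefficient \<open>x\<^sub>n\<close> of the expansion of \<open>f\<close> as the sum of all \<open>x\<^sub>n e\<^sub>n\<close>, where
  \<open>e\<^sub>n z = z powi n\<close>, as a Bochner integral; on the circle \<open>z powi (- n)\<close> is the conjugate of \<open>e\<^sub>n z\<close>.\<close>

definition fourier_coeff :: "'h::{chilbert_space,second_countable_topology} L2 \<Rightarrow> int \<Rightarrow> 'h" where
  "fourier_coeff f n = (LINT z|circle_measure. (z powi (- n)) *\<^sub>C rep_L2 f z)"

definition H2 :: "'h::{chilbert_space,second_countable_topology} L2 set" where
  "H2 = {f. \<forall>n<0. fourier_coeff f n = 0}"

lemma AE_mult_op:
  "square_integrable (\<lambda>z. F z (rep_L2 f z)) \<Longrightarrow>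
   AE z in circle_measure. rep_L2 (mult_op F f) z = F z (rep_L2 f z)"
  unfolding mult_op_def by (rule rep_abs_L2)

lemma AE_mult_op_const:
  assumes "bounded_linear A"
  shows "AE z in circle_measure. rep_L2 (mult_op (\<lambda>z. A) f) z = A (rep_L2 f z)"
proof (rule AE_mult_op)
  note f = square_integrable_rep_L2[of f, unfolded square_integrable_def]
  obtain K where K: "norm (A x) \<le> norm x * K" for x
    using bounded_linear.bounded[OF assms] by blast
  have [measurable]: "A \<in> borel_measurable borel"
    by (intro borel_measurable_continuous_onI linear_continuous_on assms)
  have [measurable]: "rep_L2 f \<in> borel_measurable circle_measure"
    using f by simp
  show "square_integrable (\<lambda>z. A (rep_L2 f z))"
    unfolding square_integrable_def
  proof
    show "(\<lambda>z. A (rep_L2 f z)) \<in> borel_measurable circle_measure"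
      by measurable
    have "integrable circle_measure (\<lambda>z. (norm (rep_L2 f z))\<^sup>2 * K\<^sup>2)"
      using f by simp
    then show "integrable circle_measure (\<lambda>z. (norm (A (rep_L2 f z)))\<^sup>2)"
    proof (rule Bochner_Integration.integrable_bound)
      have "(norm (A x))\<^sup>2 \<le> (norm x)\<^sup>2 * K\<^sup>2" for x
        using power_mono[OF K[of x], of 2] by (simp add: power_mult_distrib)
      then show "AE z in circle_measure.
          norm ((norm (A (rep_L2 f z)))\<^sup>2) \<le> norm ((norm (rep_L2 f z))\<^sup>2 * K\<^sup>2)"
        by simp
    qed measurable
  qed
qed

lemma space_circle_measure: "space circle_measure = sphere 0 1"
  by (simp add: circle_measure_def space_restrict_space)

lemma sets_circle_measure: "sets circle_measure = sets (restrict_space borel (sphere 0 1))"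
  by (simp add: circle_measure_def)

lemma AE_M_z: "AE z in circle_measure. rep_L2 (M_z f) z = z *\<^sub>C rep_L2 f z"
  unfolding M_z_def
proof (rule AE_mult_op)
  note f = square_integrable_rep_L2[of f, unfolded square_integrable_def]
  have "(\<lambda>z. z) \<in> borel_measurable circle_measure"
    by (simp add: measurable_cong_sets[OF sets_circle_measure refl] measurable_restrict_space1)
  then have "(\<lambda>z. z *\<^sub>C rep_L2 f z) \<in> borel_measurable circle_measure"
    using f by (auto intro: borel_measurable_scaleC)
  moreover have "integrable circle_measure (\<lambda>z. (norm (z *\<^sub>C rep_L2 f z))\<^sup>2) \<longleftrightarrow>
      integrable circle_measure (\<lambda>z. (norm (rep_L2 f z))\<^sup>2)"
    by (intro Bochner_Integration.integrable_cong) (auto simp: norm_scaleC space_circle_measure)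
  ultimately show "square_integrable (\<lambda>z. z *\<^sub>C rep_L2 f z)"
    using f by (simp add: square_integrable_def)
qed

lemma measurable_cnj_circle: "cnj \<in> measurable circle_measure circle_measure"
proof -
  have "cnj \<in> borel_measurable borel"
    by (intro borel_measurable_continuous_onI continuous_intros)
  then have "cnj \<in> measurable (restrict_space borel (sphere 0 1)) (restrict_space borel (sphere 0 1))"
    by (intro measurable_restrict_space3) auto
  then show ?thesis
    by (simp add: measurable_cong_sets[OF sets_circle_measure sets_circle_measure])
qed

lemma distr_circle_measure_cnj: "distr circle_measure circle_measure cnj = circle_measure"
proof -
  define N :: "real measure" where "N = uniform_measure lborel {0..1}"
  define B :: "complex measure" where "B = restrict_space borel (sphere 0 1)"
  have N: "emeasure N A = emeasure lborel ({0..1} \<inter> A)" if "A \<in> sets borel" for A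
    using that by (simp add: N_def divide_ennreal_def)
  have sN [measurable_cong]: "sets N = sets borel"
    by (simp add: N_def)
  have e: "(\<lambda>t. cis (2 * pi * t)) \<in> measurable N B"
    unfolding B_def by (intro measurable_restrict_space2) (auto simp: measurable_cong_sets[OF sN refl]
        intro!: borel_measurable_continuous_onI continuous_intros)
  have c: "cnj \<in> measurable B B"
    using measurable_cnj_circle
    by (simp add: B_def measurable_cong_sets[OF sets_circle_measure sets_circle_measure])
  have flip: "lborel = distr lborel borel (\<lambda>t::real. 1 - t)"
    using lborel_real_affine[of "-1" 1] by (simp add: density_1)
  have flipN: "distr N N (\<lambda>t. 1 - t) = N"
  proof (rule measure_eqI)
    fix A assume "A \<in> sets (distr N N (\<lambda>t. 1 - t))"
    then have A [measurable]: "A \<in> sets borel"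
      by (simp add: sN)
    have "emeasure (distr N N (\<lambda>t. 1 - t)) A = emeasure N ((\<lambda>t. 1 - t) -` A)"
      using A by (subst emeasure_distr) (auto simp: sN N_def)
    also have "\<dots> = emeasure lborel ({0..1} \<inter> (\<lambda>t. 1 - t) -` A)"
      using measurable_sets[of "\<lambda>t::real. 1 - t" borel borel A] by (intro N) simp
    also have "{0..1} \<inter> (\<lambda>t. 1 - t) -` A = (\<lambda>t::real. 1 - t) -` ({0..1} \<inter> A) \<inter> space lborel"
      by auto
    also have "emeasure lborel \<dots> = emeasure (distr lborel borel (\<lambda>t::real. 1 - t)) ({0..1} \<inter> A)"
      by (subst emeasure_distr) auto
    also have "\<dots> = emeasure N A"
      by (simp add: flip[symmetric] N)
    finally show "emeasure (distr N N (\<lambda>t. 1 - t)) A = emeasure N A" .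
  qed simp
  have "distr circle_measure circle_measure cnj = distr (distr N B (\<lambda>t. cis (2 * pi * t))) B cnj"
    by (intro distr_cong) (auto simp: circle_measure_def N_def B_def)
  also have "\<dots> = distr N B (\<lambda>t. cnj (cis (2 * pi * t)))"
    by (subst distr_distr[OF c e]) (simp add: comp_def)
  also have "(\<lambda>t. cnj (cis (2 * pi * t))) = (\<lambda>t. cis (2 * pi * (1 - t)))"
    by (simp add: fun_eq_iff complex_eq_iff right_diff_distrib)
  also have "distr N B \<dots> = distr (distr N N (\<lambda>t. 1 - t)) B (\<lambda>t. cis (2 * pi * t))"
    by (subst distr_distr[OF e]) (auto simp: comp_def)
  also have "\<dots> = circle_measure"
    by (simp only: flipN) (simp add: circle_measure_def N_def B_def)
  finally show ?thesis .
qed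

lemma norm_conjugation: "conjugation J \<Longrightarrow> norm (J x) = norm x"
  by (simp add: norm_eq_sqrt_inner inner_eq_Re_cinner conjugation_def)

lemma AE_J_star:
  assumes J: "conjugation J"
  shows "AE z in circle_measure. rep_L2 (J_star J f) z = J (rep_L2 f (cnj z))"
  unfolding J_star_def
proof (rule rep_abs_L2)
  note f = square_integrable_rep_L2[of f, unfolded square_integrable_def]
  have "bounded_linear J"
    using J by (intro bounded_linear_intro[where K = 1])
      (auto simp: norm_conjugation scaleR_scaleC conjugation_def)
  then have [measurable]: "J \<in> borel_measurable borel"
    by (intro borel_measurable_continuous_onI linear_continuous_on)
  note [measurable] = measurable_cnj_circle
  have [measurable]: "rep_L2 f \<in> borel_measurable circle_measure"
    using f by simp
  have "integrable circle_measure (\<lambda>z. (norm (rep_L2 f (cnj z)))\<^sup>2)"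
    using f by (subst (asm) distr_circle_measure_cnj[symmetric]) (simp add: integrable_distr_eq)
  then show "square_integrable (\<lambda>z. J (rep_L2 f (cnj z)))"
    by (simp add: square_integrable_def norm_conjugation[OF J])
qed

end

theory Submission
  imports Defs
begin

text \<open>
  \<open>C\<close> is determined by what it does to the constant functions. It preserves \<open>H2\<close>, and it commutes with
  the shift \<open>M_z\<close>, so it also maps \<open>z H2\<close> into itself; since it preserves orthogonality up to exchanging the
  arguments of the inner product, it preserves the orthogonal complement of \<open>z H2\<close> in \<open>H2\<close>, which
  consists of the constants (\<open>conjugation_constant_is_constant\<close>). Hence \<open>C\<close> induces a map \<open>V\<close> on the
  coefficient space, and \<open>V\<close> inherits the defining identities of a conjugation
  (\<open>conjugation_on_constants\<close>). Commutation with the shift, in both directions, then gives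
  \<open>C (x e\<^sub>n) = V x e\<^sub>n\<close> for every integer \<open>n\<close> (\<open>conjugation_monomial\<close>), and this is also
  how \<open>f \<mapsto> V (f (cnj z))\<close> acts, because \<open>V\<close> conjugates \<open>(cnj z)\<^sup>n\<close> back to \<open>z\<^sup>n\<close>. So
  \<open>C = J_star V\<close> (\<open>conjugation_eq_J_star\<close>).

  It remains to compare two conjugations \<open>V\<close> and \<open>J\<close> of the same space: \<open>U\<^sub>0 = V \<circ> J\<close> is linear, its
  adjoint and inverse is \<open>J \<circ> V = J \<circ> U\<^sub>0 \<circ> J\<close>, and both factorizations of \<open>J_star V\<close> are pointwise
  cancellations of \<open>J \<circ> J\<close>.

  The analytic ingredient is that an element of \<open>L2\<close> is determined by its Fourier coefficients
  (\<open>L2_eqI_fourier_coeff\<close>). Pairing with a countable dense set of vectors reduces this to scalar functions: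
  an integrable function whose moments against all powers of \<open>z\<close> vanish is zero almost everywhere
  (\<open>zero_moments_AE_zero\<close>). The Weierstrass theorem extends the vanishing from monomials to continuous
  functions, dominated convergence to indicators of closed sets, and Dynkin's theorem to those of Borel sets.
\<close>

section \<open>Integration against monomials on the circle\<close>

lemma measurable_cis_circle:
  "(\<lambda>t. cis (2 * pi * t))
     \<in> measurable (uniform_measure lborel {0..1}) (restrict_space borel (sphere 0 1))"
  by (intro measurable_restrict_space2)
     (auto simp: measurable_cong_sets[OF sets_uniform_measure refl]
        intro!: borel_measurable_continuous_onI continuous_intros)

lemma finite_measure_circle: "finite_measure circle_measure"
  unfolding circle_measure_def
  by (intro finite_measure.finite_measure_distr measurable_cis_circle finite_measureI) simp

lemma circle_spaceD: "z \<in> space circle_measure \<Longrightarrow> cmod z = 1"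
  by (simp add: space_circle_measure)

lemma borel_measurable_circle_continuous_on:
  assumes "continuous_on (sphere 0 1) g"
  shows "g \<in> borel_measurable circle_measure"
  using borel_measurable_continuous_on_restrict[OF assms]
  by (simp add: measurable_cong_sets[OF sets_circle_measure refl])

lemma continuous_on_circle_powi: "continuous_on (sphere 0 1) (\<lambda>z::complex. z powi n)"
  by (intro continuous_intros) auto

lemma cmod_powi_circle: "cmod z = 1 \<Longrightarrow> cmod (z powi n) = 1"
  by (simp add: norm_power_int)

lemma cnj_powi_circle:
  assumes "cmod z = 1"
  shows "cnj (z powi n) = z powi (- n)"
proof -
  have "z powi n * cnj (z powi n) = 1"
    using cmod_powi_circle[OF assms, of n] complex_norm_square[of "z powi n"]
    by (simp del: complex_cnj_power_int)
  then have "cnj (z powi n) = inverse (z powi n)"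
    by (metis inverse_unique)
  then show ?thesis
    by (simp add: power_int_minus)
qed

lemma powi_mult_circle: "cmod z = 1 \<Longrightarrow> z powi m * z powi n = z powi (m + n)"
  by (subst power_int_add) auto

lemma integrable_circle_continuous_mult:
  fixes g \<phi> :: "complex \<Rightarrow> complex"
  assumes g: "continuous_on (sphere 0 1) g" and \<phi>: "integrable circle_measure \<phi>"
  shows "integrable circle_measure (\<lambda>z. g z * \<phi> z)"
proof -
  have "bounded (g ` sphere 0 1)"
    using compact_continuous_image[OF g] by (simp add: compact_imp_bounded)
  then obtain B where B: "\<And>z. z \<in> sphere 0 1 \<Longrightarrow> cmod (g z) \<le> B"
    unfolding bounded_iff by blast
  show ?thesis
  proof (rule Bochner_Integration.integrable_bound)
    show "integrable circle_measure (\<lambda>z. B * cmod (\<phi> z))"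
      using \<phi> by simp
    show "(\<lambda>z. g z * \<phi> z) \<in> borel_measurable circle_measure"
      using borel_measurable_circle_continuous_on[OF g] \<phi> by simp
    show "AE z in circle_measure. norm (g z * \<phi> z) \<le> norm (B * cmod (\<phi> z))"
    proof (rule AE_I2)
      fix z assume "z \<in> space circle_measure"
      then have "cmod (g z) \<le> B"
        using B by (simp add: space_circle_measure)
      then show "norm (g z * \<phi> z) \<le> norm (B * cmod (\<phi> z))"
        by (smt (verit) mult_right_mono norm_ge_zero norm_mult real_norm_def)
    qed
  qed
qed

text \<open>On the circle every real-linear function of \<open>z\<close> is a combination of \<open>z\<close> and its inverse, so
  multiplying by it permutes and combines moments. Quantifying over \<open>\<phi>\<close> makes the induction work: the
  product of \<open>\<phi>\<close> with one polynomial is again a function with vanishing moments.\<close>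

lemma zero_moments_mult_polynomial:
  fixes \<phi> :: "complex \<Rightarrow> complex"
  assumes "real_polynomial_function p" "integrable circle_measure \<phi>"
    and "\<And>n. (LINT z|circle_measure. z powi n * \<phi> z) = 0"
  shows "(LINT z|circle_measure. z powi n * (complex_of_real (p z) * \<phi> z)) = 0"
  using assms
proof (induction p arbitrary: \<phi> n rule: real_polynomial_function.induct)
  case (linear h)
  \<comment> \<open>the Wirtinger derivative of \<open>h\<close> with respect to \<open>z\<close>\<close>
  define a where "a = (complex_of_real (h 1) - \<i> * complex_of_real (h \<i>)) / 2"
  have h: "complex_of_real (h z) = a * z + cnj a * cnj z" for z
  proof -
    have "h z = h (Re z *\<^sub>R 1 + Im z *\<^sub>R \<i>)"
      by (simp add: complex_eq[symmetric] scaleR_conv_of_real mult.commute)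
    also have "\<dots> = Re z * h 1 + Im z * h \<i>"
      using linear(1) by (simp add: linear_add linear_cmul bounded_linear.linear)
    finally show ?thesis
      by (simp add: a_def complex_eq_iff field_simps)
  qed
  have "(LINT z|circle_measure. z powi n * (complex_of_real (h z) * \<phi> z))
      = (LINT z|circle_measure. a * (z powi (n + 1) * \<phi> z) + cnj a * (z powi (n - 1) * \<phi> z))"
  proof (intro Bochner_Integration.integral_cong refl)
    fix z assume "z \<in> space circle_measure"
    then have z: "cmod z = 1"
      by (rule circle_spaceD)
    have "z powi (n + 1) = z powi n * z" "z powi (n - 1) = z powi n * cnj z"
      using powi_mult_circle[OF z, of n 1] powi_mult_circle[OF z, of n "-1"] cnj_powi_circle[OF z, of 1]
      by auto
    then show "z powi n * (complex_of_real (h z) * \<phi> z)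
        = a * (z powi (n + 1) * \<phi> z) + cnj a * (z powi (n - 1) * \<phi> z)"
      by (simp add: h algebra_simps)
  qed
  also have "\<dots> = 0"
    using linear(2,3) integrable_circle_continuous_mult[OF continuous_on_circle_powi linear(2)] by simp
  finally show ?case .
next
  case (const c)
  have "(LINT z|circle_measure. z powi n * (complex_of_real c * \<phi> z))
      = (LINT z|circle_measure. complex_of_real c * (z powi n * \<phi> z))"
    by (simp add: mult.left_commute)
  then show ?case
    using const by simp
next
  case (add f g)
  have int: "integrable circle_measure (\<lambda>z. z powi n * (complex_of_real (q z) * \<phi> z))"
    if "real_polynomial_function q" for q
    using that add.prems(1)
    by (intro integrable_circle_continuous_mult continuous_on_circle_powi continuous_on_of_real
        continuous_on_polymonial_function) (auto simp: real_polynomial_function_eq)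
  show ?case
    using add.IH add.prems int[OF add.hyps(1)] int[OF add.hyps(2)] by (simp add: algebra_simps)
next
  case (mult f g)
  have "integrable circle_measure (\<lambda>z. complex_of_real (g z) * \<phi> z)"
    using mult.hyps mult.prems(1)
    by (intro integrable_circle_continuous_mult continuous_on_of_real
        continuous_on_polymonial_function) (auto simp: real_polynomial_function_eq)
  from mult.IH(1)[OF this mult.IH(2)[OF mult.prems]] show ?case
    by (simp add: mult.assoc)
qed

text \<open>By the Weierstrass theorem a continuous function on the circle is a uniform limit of real polynomials
  in the real and imaginary part of \<open>z\<close>, and the error in the integral is at most the uniform error times
  the \<open>L1\<close> norm of \<open>\<phi>\<close>.\<close>

lemma zero_moments_continuous:
  fixes \<phi> :: "complex \<Rightarrow> complex" and g :: "complex \<Rightarrow> real"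
  assumes \<phi>: "integrable circle_measure \<phi>"
    and moments: "\<And>n. (LINT z|circle_measure. z powi n * \<phi> z) = 0"
    and g: "continuous_on (sphere 0 1) g"
  shows "(LINT z|circle_measure. complex_of_real (g z) * \<phi> z) = 0"
proof -
  define I where "I = (LINT z|circle_measure. cmod (\<phi> z))"
  have I: "I \<ge> 0"
    by (simp add: I_def)
  have "cmod (LINT z|circle_measure. complex_of_real (g z) * \<phi> z) \<le> e" if "e > 0" for e
  proof -
    \<comment> \<open>\<open>I + 1\<close> instead of \<open>I\<close> keeps the tolerance defined when \<open>\<phi>\<close> vanishes\<close>
    have "e / (I + 1) > 0"
      using that I by simp
    then obtain p where p: "real_polynomial_function p"
      and close: "\<And>z. z \<in> sphere 0 1 \<Longrightarrow> \<bar>g z - p z\<bar> < e / (I + 1)"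
      using Stone_Weierstrass_real_polynomial_function[OF compact_sphere g] by metis
    have cont_p: "continuous_on (sphere 0 1) p"
      using p by (intro continuous_on_polymonial_function) (simp add: real_polynomial_function_eq)
    have int: "integrable circle_measure (\<lambda>z. complex_of_real (g z) * \<phi> z)"
      "integrable circle_measure (\<lambda>z. complex_of_real (p z) * \<phi> z)"
      by (intro integrable_circle_continuous_mult continuous_on_of_real g cont_p \<phi>)+
    have "(LINT z|circle_measure. complex_of_real (p z) * \<phi> z) = 0"
      using zero_moments_mult_polynomial[OF p \<phi> moments, of 0] by simp
    then have "(LINT z|circle_measure. complex_of_real (g z) * \<phi> z)
        = (LINT z|circle_measure. complex_of_real (g z) * \<phi> z - complex_of_real (p z) * \<phi> z)"
      using int by simp
    also have "cmod \<dots> \<le> (LINT z|circle_measure. e / (I + 1) * cmod (\<phi> z))"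
    proof (rule Bochner_Integration.integral_norm_bound_integral)
      fix z assume "z \<in> space circle_measure"
      then have "\<bar>g z - p z\<bar> \<le> e / (I + 1)"
        using close[of z] by (simp add: space_circle_measure)
      then have "\<bar>g z - p z\<bar> * cmod (\<phi> z) \<le> e / (I + 1) * cmod (\<phi> z)"
        by (rule mult_right_mono) simp
      moreover have "complex_of_real (g z) * \<phi> z - complex_of_real (p z) * \<phi> z
          = complex_of_real (g z - p z) * \<phi> z"
        by (simp add: algebra_simps)
      ultimately show "cmod (complex_of_real (g z) * \<phi> z - complex_of_real (p z) * \<phi> z)
          \<le> e / (I + 1) * cmod (\<phi> z)"
        by (simp only: norm_mult norm_of_real)
    qed (use int \<phi> in auto)
    also have "\<dots> = e * (I / (I + 1))"
      by (simp add: I_def)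
    also have "\<dots> \<le> e"
      using that I by (simp add: mult_le_cancel_left2 divide_simps)
    finally show ?thesis .
  qed
  then have "cmod (LINT z|circle_measure. complex_of_real (g z) * \<phi> z) \<le> 0"
    by (rule field_le_epsilon) simp
  then show ?thesis
    by simp
qed

text \<open>The indicator of a nonempty closed set is the pointwise limit of the continuous functions
  \<open>max 0 (1 - k * infdist z A)\<close>, all bounded by \<open>1\<close>.\<close>

lemma zero_moments_closed:
  fixes \<phi> :: "complex \<Rightarrow> complex"
  assumes \<phi>: "integrable circle_measure \<phi>"
    and moments: "\<And>n. (LINT z|circle_measure. z powi n * \<phi> z) = 0"
    and A: "closed A"
  shows "(LINT z|circle_measure. indicator A z *\<^sub>R \<phi> z) = 0"
proof (cases "A = {}")
  case False
  define g where "g k z = max 0 (1 - real k * infdist z A)" for k z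
  have cont: "continuous_on (sphere 0 1) (g k)" for k
    unfolding g_def by (intro continuous_intros)
  have A_sets: "A \<inter> space circle_measure \<in> sets circle_measure"
    using A by (auto simp: sets_circle_measure space_circle_measure sets_restrict_space)
  have [measurable]: "indicat_real A \<in> borel_measurable circle_measure"
    using A_sets by (simp add: borel_measurable_indicator_iff Int_commute)
  have "(\<lambda>k. LINT z|circle_measure. g k z *\<^sub>R \<phi> z)
      \<longlonglongrightarrow> (LINT z|circle_measure. indicator A z *\<^sub>R \<phi> z)"
  proof (rule integral_dominated_convergence)
    show "(\<lambda>z. g k z *\<^sub>R \<phi> z) \<in> borel_measurable circle_measure" for k
      using borel_measurable_circle_continuous_on[OF cont] \<phi> by simp
    show "(\<lambda>z. indicat_real A z *\<^sub>R \<phi> z) \<in> borel_measurable circle_measure"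
      using \<phi> by simp
    show "integrable circle_measure (\<lambda>z. cmod (\<phi> z))"
      using \<phi> by simp
    have "0 \<le> g k z \<and> g k z \<le> 1" for k z
      by (simp add: g_def infdist_nonneg)
    then show "AE z in circle_measure. norm (g k z *\<^sub>R \<phi> z) \<le> cmod (\<phi> z)" for k
      by (simp add: mult_left_le_one_le)
    have "(\<lambda>k. g k z) \<longlonglongrightarrow> indicator A z" for z
    proof (cases "z \<in> A")
      case True
      then show ?thesis
        by (simp add: g_def)
    next
      case out: False
      then have pos: "infdist z A > 0"
        using A False by (simp add: in_closed_iff_infdist_zero infdist_nonneg less_le)
      obtain N :: nat where N: "1 < real N * infdist z A"
        using reals_Archimedean3[OF pos] by blast
      have "g k z = 0" if "k \<ge> N" for k
      proof -
        have "real N * infdist z A \<le> real k * infdist z A"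
          using that pos by (intro mult_right_mono) auto
        then show ?thesis
          using N by (simp add: g_def)
      qed
      then have "\<forall>\<^sub>F k in sequentially. g k z = 0"
        by (auto simp: eventually_sequentially)
      then show ?thesis
        using out by (simp add: tendsto_eventually)
    qed
    then show "AE z in circle_measure. (\<lambda>k. g k z *\<^sub>R \<phi> z) \<longlonglongrightarrow> indicator A z *\<^sub>R \<phi> z"
      by (intro AE_I2 tendsto_intros)
  qed
  moreover have "(LINT z|circle_measure. g k z *\<^sub>R \<phi> z) = 0" for k
    using zero_moments_continuous[OF \<phi> moments cont] by (simp add: scaleR_conv_of_real)
  ultimately show ?thesis
    by (simp add: LIMSEQ_const_iff)
qed simp

text \<open>The sets over which \<open>\<phi>\<close> integrates to zero form a Dynkin system containing the closed sets, which
  are stable under intersection; the whole circle belongs to it by the moment of order zero. Sets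
  of complex numbers are traced on the circle because the closed sets generate the Borel sets of the plane.\<close>

lemma zero_moments_borel:
  fixes \<phi> :: "complex \<Rightarrow> complex"
  assumes \<phi>: "integrable circle_measure \<phi>"
    and moments: "\<And>n. (LINT z|circle_measure. z powi n * \<phi> z) = 0"
    and A: "A \<in> sets circle_measure"
  shows "(LINT z:A|circle_measure. \<phi> z) = 0"
proof -
  have traces: "B \<inter> space circle_measure \<in> sets circle_measure" if "B \<in> sets borel" for B
    using that by (auto simp: sets_circle_measure space_circle_measure sets_restrict_space)
  have int: "set_integrable circle_measure (B \<inter> space circle_measure) \<phi>" if "B \<in> sets borel" for B
    unfolding set_integrable_def
    using traces[OF that] \<phi> by (intro integrable_mult_indicator)
  have borel: "sets borel = sigma_sets UNIV (Collect (closed :: complex set \<Rightarrow> bool))"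
    by (simp add: borel_eq_closed)
  have whole: "(LINT z:space circle_measure|circle_measure. \<phi> z) = 0"
    using moments[of 0] by (simp add: set_integral_space[OF \<phi>])
  have "(LINT z:(B \<inter> space circle_measure)|circle_measure. \<phi> z) = 0" if "B \<in> sets borel" for B
  proof -
    have "Int_stable (Collect (closed :: complex set \<Rightarrow> bool))"
      by (auto simp: Int_stable_def)
    moreover have "Collect closed \<subseteq> Pow (UNIV :: complex set)"
      by simp
    moreover have "B \<in> sigma_sets UNIV (Collect closed)"
      using that borel by simp
    ultimately show ?thesis
    proof (induction B rule: sigma_sets_induct_disjoint)
      case (basic B)
      have "(LINT z:(B \<inter> space circle_measure)|circle_measure. \<phi> z)
          = (LINT z|circle_measure. indicator B z *\<^sub>R \<phi> z)"
        unfolding set_lebesgue_integral_def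
        by (intro Bochner_Integration.integral_cong) (auto simp: indicator_def)
      with basic show ?case
        using zero_moments_closed[OF \<phi> moments] by simp
    next
      case empty
      show ?case
        by (simp add: set_lebesgue_integral_def)
    next
      case (compl B)
      then have B: "B \<in> sets borel" "UNIV - B \<in> sets borel"
        using borel by auto
      have split: "B \<inter> space circle_measure \<union> (UNIV - B) \<inter> space circle_measure = space circle_measure"
        by blast
      have "B \<inter> space circle_measure \<inter> ((UNIV - B) \<inter> space circle_measure) = {}"
        by blast
      from set_integral_Un[OF this int[OF B(1)] int[OF B(2)]] have "(LINT z:space circle_measure|circle_measure. \<phi> z)
          = (LINT z:(B \<inter> space circle_measure)|circle_measure. \<phi> z)
            + (LINT z:((UNIV - B) \<inter> space circle_measure)|circle_measure. \<phi> z)"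
        by (simp only: split)
      then show ?case
        using compl whole by simp
    next
      case (union B)
      then have B: "B i \<in> sets borel" for i
        using borel by auto
      have "(LINT z:(\<Union>i. B i \<inter> space circle_measure)|circle_measure. \<phi> z)
          = (\<Sum>i. LINT z:(B i \<inter> space circle_measure)|circle_measure. \<phi> z)"
      proof (rule lebesgue_integral_countable_add)
        show "B i \<inter> space circle_measure \<in> sets circle_measure" for i
          by (rule traces[OF B])
        show "B i \<inter> space circle_measure \<inter> (B j \<inter> space circle_measure) = {}" if "i \<noteq> j" for i j
          using union.hyps(1) that by (auto simp: disjoint_family_on_def)
        show "set_integrable circle_measure (\<Union>i. B i \<inter> space circle_measure) \<phi>"
          using int[of "\<Union>i. B i"] B by (simp add: Int_UN_distrib2)
      qed
      then show ?case
        using union by (simp add: Int_UN_distrib2)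
    qed
  qed
  moreover obtain B where "B \<in> sets borel" "A = B \<inter> space circle_measure"
    using A by (auto simp: sets_circle_measure space_circle_measure sets_restrict_space)
  ultimately show ?thesis
    by simp
qed

lemma zero_moments_AE_zero:
  fixes \<phi> :: "complex \<Rightarrow> complex"
  assumes \<phi>: "integrable circle_measure \<phi>"
    and moments: "\<And>n. (LINT z|circle_measure. z powi n * \<phi> z) = 0"
  shows "AE z in circle_measure. \<phi> z = 0"
proof -
  have *: "(LINT z:A|circle_measure. T (\<phi> z)) = 0"
    if A: "A \<in> sets circle_measure" and T: "bounded_linear (T :: complex \<Rightarrow> real)" for A T
  proof -
    have "T (LINT z:A|circle_measure. \<phi> z) = (LINT z|circle_measure. T (indicator A z *\<^sub>R \<phi> z))"
      unfolding set_lebesgue_integral_def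
      using A \<phi> by (intro integral_bounded_linear[symmetric] T integrable_mult_indicator)
    also have "\<dots> = (LINT z:A|circle_measure. T (\<phi> z))"
      unfolding set_lebesgue_integral_def
      by (simp add: linear_cmul[OF bounded_linear.linear[OF T]])
    finally show ?thesis
      using zero_moments_borel[OF \<phi> moments A] linear_0[OF bounded_linear.linear[OF T]] by simp
  qed
  have "AE z in circle_measure. T (\<phi> z) = 0" if T: "bounded_linear (T :: complex \<Rightarrow> real)" for T
  proof (rule density_unique_real)
    show "integrable circle_measure (\<lambda>z. T (\<phi> z))"
      using integrable_bounded_linear[OF T \<phi>] .
    show "(LINT z:A|circle_measure. T (\<phi> z)) = (LINT z:A|circle_measure. 0)"
      if "A \<in> sets circle_measure" for A
      using *[OF that T] by (simp add: set_lebesgue_integral_def)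
  qed simp
  from this[OF bounded_linear_Re] this[OF bounded_linear_Im]
  show ?thesis
    by eventually_elim (simp add: complex_eq_iff)
qed

lemma integral_circle_powi:
  "(LINT z|circle_measure. z powi n) = (if n = 0 then 1 else 0)"
proof -
  have "(LINT z|circle_measure. z powi n)
      = (LINT t|uniform_measure lborel {0..1}. cis (2 * pi * t) powi n)"
    unfolding circle_measure_def
    using borel_measurable_circle_continuous_on[OF continuous_on_circle_powi, of n]
    by (intro integral_distr measurable_cis_circle) (simp add: measurable_cong_sets[OF sets_circle_measure refl])
  also have "\<dots> = (LINT t|density lborel (\<lambda>t. ennreal (indicator {0..1} t)). cis (2 * pi * n * t))"
    by (simp add: uniform_measure_def divide_ennreal_def cis_power_int mult_ac ennreal_indicator)
  also have "\<dots> = (LINT t|lborel. indicator {0..1} t *\<^sub>R cis (2 * pi * n * t))"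
    by (intro integral_density) (auto intro!: borel_measurable_continuous_onI continuous_intros)
  also have "\<dots> = (if n = 0 then 1 else 0)"
  proof (cases "n = 0")
    case False
    define c where "c = 2 * pi * complex_of_int n * \<i>"
    define F where "F t = exp (c * complex_of_real t) / c" for t
    have c: "c \<noteq> 0" "cis (2 * pi * n * t) = exp (c * complex_of_real t)" for t
      using False by (auto simp: c_def cis_conv_exp mult_ac)
    have "(LINT t|lborel. indicator {0..1} t *\<^sub>R cis (2 * pi * n * t)) = F 1 - F 0"
    proof (rule integral_FTC_Icc)
      fix t :: real
      have "((\<lambda>w. exp (c * w) / c) has_field_derivative exp (c * complex_of_real t))
          (at (complex_of_real t))"
        using c(1) by (auto intro!: derivative_eq_intros)
      then show "(F has_vector_derivative cis (2 * pi * n * t)) (at t within {0..1})"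
        unfolding F_def c(2) by (rule has_vector_derivative_real_field)
    qed (auto intro!: continuous_intros)
    also have "F 1 = F 0"
      using c(2)[of 1] c(2)[of 0] by (simp add: F_def cis_multiple_2pi)
    finally show ?thesis
      using False by simp
  qed simp
  finally show ?thesis .
qed

section \<open>Fourier coefficients of vector-valued functions\<close>

lemma L2_eqI:
  assumes "AE z in circle_measure. rep_L2 f z = rep_L2 g z"
  shows "f = g"
  using assms Quotient_rel_rep[OF Quotient_L2, of f g]
  by (simp add: L2_rel_def square_integrable_rep_L2)

lemma cinner_zero_left [simp]: "cinner 0 (x :: 'h::complex_inner) = 0"
  using cinner_add_left[of 0 0 x] by simp

lemma cinner_diff_left: "cinner (x - y) z = cinner x z - cinner y (z :: 'h::complex_inner)"
  using cinner_add_left[of "x - y" y z] by simp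

lemma cinner_self: "cinner x x = complex_of_real ((norm (x :: 'h::complex_inner))\<^sup>2)"
proof (rule complex_eqI)
  show "Im (cinner x x) = Im (complex_of_real ((norm x)\<^sup>2))"
    using arg_cong[OF cinner_commute[of x x], of Im] by simp
qed (simp add: power2_norm_eq_inner inner_eq_Re_cinner)

lemma cinner_eqI:
  assumes "\<And>z. cinner x z = cinner y (z :: 'h::complex_inner)"
  shows "x = y"
  using cinner_self[of "x - y"] assms by (simp add: cinner_diff_left)

lemma cinner_left_bounded_linear: "bounded_linear (\<lambda>x :: 'h::complex_inner. cinner x y)"
  by (intro bounded_linear_intro[where K = "norm y"])
     (auto simp: cinner_add_left scaleR_scaleC cinner_scaleC_left scaleR_conv_of_real cmod_cinner_le)

lemma cinner_L2_AE:
  fixes f g :: "'h::{complex_inner,second_countable_topology} L2"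
  assumes "AE z in circle_measure. rep_L2 f z = u z" "AE z in circle_measure. rep_L2 g z = v z"
    and "u \<in> borel_measurable circle_measure" "v \<in> borel_measurable circle_measure"
  shows "cinner f g = (LINT z|circle_measure. cinner (u z) (v z))"
  unfolding cinner_L2.rep_eq
proof (rule integral_cong_AE)
  show "AE z in circle_measure. cinner (rep_L2 f z) (rep_L2 g z) = cinner (u z) (v z)"
    using assms(1,2) by eventually_elim simp
qed (use assms(3,4) square_integrable_rep_L2[of f] square_integrable_rep_L2[of g] in
    \<open>auto simp: square_integrable_def intro: borel_measurable_cinner\<close>)

lemma borel_measurable_rep_L2 [measurable]:
  "rep_L2 (f :: 'h::{complex_inner,second_countable_topology} L2) \<in> borel_measurable circle_measure"
  using square_integrable_rep_L2[of f] by (simp add: square_integrable_def)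

lemma borel_measurable_powi_circle: "(\<lambda>z. z powi n) \<in> borel_measurable circle_measure"
  by (rule borel_measurable_circle_continuous_on[OF continuous_on_circle_powi])

definition monomial_L2 :: "int \<Rightarrow> 'h::{complex_inner,second_countable_topology} \<Rightarrow> 'h L2" where
  "monomial_L2 n y = abs_L2 (\<lambda>z. (z powi n) *\<^sub>C y)"

lemma borel_measurable_monomial:
  fixes y :: "'h::{complex_inner,second_countable_topology}"
  shows "(\<lambda>z. (z powi n) *\<^sub>C y) \<in> borel_measurable circle_measure"
  by (intro borel_measurable_scaleC borel_measurable_powi_circle) simp

lemma AE_monomial_L2:
  fixes y :: "'h::{complex_inner,second_countable_topology}"
  shows "AE z in circle_measure. rep_L2 (monomial_L2 n y) z = (z powi n) *\<^sub>C y"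
  unfolding monomial_L2_def
proof (rule rep_abs_L2)
  interpret finite_measure circle_measure
    by (rule finite_measure_circle)
  have "integrable circle_measure (\<lambda>z. (norm ((z powi n) *\<^sub>C y))\<^sup>2)
      \<longleftrightarrow> integrable circle_measure (\<lambda>z. (norm y)\<^sup>2)"
    by (intro Bochner_Integration.integrable_cong)
      (auto simp: norm_scaleC cmod_powi_circle circle_spaceD)
  then show "square_integrable (\<lambda>z. (z powi n) *\<^sub>C y)"
    by (simp add: square_integrable_def borel_measurable_monomial)
qed

lemma integrable_rep_L2_powi:
  fixes f :: "'h::{chilbert_space,second_countable_topology} L2"
  shows "integrable circle_measure (\<lambda>z. (z powi n) *\<^sub>C rep_L2 f z)"
proof (rule Bochner_Integration.integrable_bound)
  interpret finite_measure circle_measure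
    by (rule finite_measure_circle)
  show "integrable circle_measure (\<lambda>z. 1 + (norm (rep_L2 f z))\<^sup>2)"
    using square_integrable_rep_L2[of f] by (simp add: square_integrable_def)
  show "(\<lambda>z. (z powi n) *\<^sub>C rep_L2 f z) \<in> borel_measurable circle_measure"
    by (intro borel_measurable_scaleC borel_measurable_powi_circle) simp
  have "norm x \<le> 1 + (norm x)\<^sup>2" for x :: 'h
    using sum_squares_bound[of 1 "norm x"] by (simp, smt (verit) norm_ge_zero)
  then show "AE z in circle_measure.
      norm ((z powi n) *\<^sub>C rep_L2 f z) \<le> norm (1 + (norm (rep_L2 f z))\<^sup>2)"
    by (intro AE_I2) (simp add: norm_scaleC cmod_powi_circle circle_spaceD)
qed

text \<open>Fourier coefficients are handled through this identity: it turns statements about Bochner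
  integrals into statements about inner products, which conjugations respect.\<close>

lemma cinner_monomial_L2:
  fixes f :: "'h::{chilbert_space,second_countable_topology} L2"
  shows "cinner f (monomial_L2 n y) = cinner (fourier_coeff f n) y"
proof -
  have "cinner f (monomial_L2 n y) = (LINT z|circle_measure. cinner (rep_L2 f z) ((z powi n) *\<^sub>C y))"
    by (intro cinner_L2_AE AE_monomial_L2 borel_measurable_monomial) auto
  also have "\<dots> = (LINT z|circle_measure. cinner ((z powi (- n)) *\<^sub>C rep_L2 f z) y)"
    by (intro Bochner_Integration.integral_cong refl)
      (simp add: cinner_scaleC_left cinner_scaleC_right cnj_powi_circle circle_spaceD
        del: complex_cnj_power_int)
  also have "\<dots> = cinner (fourier_coeff f n) y"
    unfolding fourier_coeff_def
    by (intro integral_bounded_linear cinner_left_bounded_linear integrable_rep_L2_powi)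
  finally show ?thesis .
qed

text \<open>The inner products with vectors of a countable dense set vanish outside one common null set, and a
  vector orthogonal to a dense set is zero.\<close>

lemma L2_eq_zero:
  fixes f :: "'h::{chilbert_space,second_countable_topology} L2"
  assumes coeffs: "\<And>n. fourier_coeff f n = 0"
  shows "f = 0"
proof -
  obtain D :: "'h set" where D: "countable D" "\<And>X. open X \<Longrightarrow> X \<noteq> {} \<Longrightarrow> \<exists>d\<in>D. d \<in> X"
    by (rule countable_dense_setE) blast
  have "AE z in circle_measure. cinner (rep_L2 f z) d = 0" for d
  proof (rule zero_moments_AE_zero)
    have "bounded_linear (\<lambda>x. cinner x d)"
      by (rule cinner_left_bounded_linear)
    from integrable_bounded_linear[OF this integrable_rep_L2_powi[of 0 f]]
    show "integrable circle_measure (\<lambda>z. cinner (rep_L2 f z) d)"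
      by (simp add: scaleC_one)
    fix n
    have "(LINT z|circle_measure. z powi n * cinner (rep_L2 f z) d)
        = (LINT z|circle_measure. cinner ((z powi (- (- n))) *\<^sub>C rep_L2 f z) d)"
      by (simp add: cinner_scaleC_left)
    also have "\<dots> = cinner (fourier_coeff f (- n)) d"
      unfolding fourier_coeff_def
      by (intro integral_bounded_linear cinner_left_bounded_linear integrable_rep_L2_powi)
    finally show "(LINT z|circle_measure. z powi n * cinner (rep_L2 f z) d) = 0"
      by (simp add: coeffs)
  qed
  then have "AE z in circle_measure. \<forall>d\<in>D. cinner (rep_L2 f z) d = 0"
    using D(1) by (simp add: AE_ball_countable)
  moreover have "x = 0" if x: "\<forall>d\<in>D. cinner x d = 0" for x :: 'h
  proof (rule ccontr)
    assume "x \<noteq> 0"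
    \<comment> \<open>vectors orthogonal to \<open>x\<close> have distance at least \<open>norm x\<close> from \<open>x\<close>, so \<open>D\<close> must avoid this ball\<close>
    then obtain d where d: "d \<in> D" "dist x d < norm x"
      using D(2)[of "ball x (norm x)"] by auto
    have "(norm x)\<^sup>2 = inner x (x - d)"
      using x d(1) by (simp add: inner_diff_right inner_eq_Re_cinner[of x d] power2_norm_eq_inner)
    also have "\<dots> \<le> norm x * dist x d"
      using norm_cauchy_schwarz[of x "x - d"] by (simp add: dist_norm)
    finally show False
      using d(2) \<open>x \<noteq> 0\<close> by (simp add: power2_eq_square)
  qed
  moreover have "AE z in circle_measure. rep_L2 (0 :: 'h L2) z = 0"
    unfolding zero_L2_def by (rule rep_abs_L2[OF square_integrable_zero])
  ultimately have "AE z in circle_measure. rep_L2 f z = rep_L2 0 z"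
    by (auto elim: eventually_elim2)
  then show ?thesis
    by (rule L2_eqI)
qed

lemma fourier_coeff_diff:
  fixes f g :: "'h::{chilbert_space,second_countable_topology} L2"
  shows "fourier_coeff (f - g) n = fourier_coeff f n - fourier_coeff g n"
  by (rule cinner_eqI) (simp add: cinner_monomial_L2[symmetric] cinner_diff_left)

lemma L2_eqI_fourier_coeff:
  fixes f g :: "'h::{chilbert_space,second_countable_topology} L2"
  assumes "\<And>n. fourier_coeff f n = fourier_coeff g n"
  shows "f = g"
  using L2_eq_zero[of "f - g"] assms by (simp add: fourier_coeff_diff)

lemma cinner_monomial_monomial:
  fixes x y :: "'h::{complex_inner,second_countable_topology}"
  shows "cinner (monomial_L2 m x) (monomial_L2 n y) = (if m = n then cinner x y else 0)"
proof -
  have "cinner (monomial_L2 m x) (monomial_L2 n y)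
      = (LINT z|circle_measure. cinner ((z powi m) *\<^sub>C x) ((z powi n) *\<^sub>C y))"
    by (intro cinner_L2_AE AE_monomial_L2 borel_measurable_monomial)
  also have "\<dots> = (LINT z|circle_measure. z powi (m - n) * cinner x y)"
  proof (intro Bochner_Integration.integral_cong refl)
    fix z assume "z \<in> space circle_measure"
    then have z: "cmod z = 1"
      by (rule circle_spaceD)
    show "cinner ((z powi m) *\<^sub>C x) ((z powi n) *\<^sub>C y) = z powi (m - n) * cinner x y"
      using powi_mult_circle[OF z, of "- n" m] cnj_powi_circle[OF z, of n]
      by (simp add: cinner_scaleC_left cinner_scaleC_right flip: mult.assoc)
  qed
  also have "\<dots> = (LINT z|circle_measure. z powi (m - n)) * cinner x y"
    by simp
  finally show ?thesis
    by (simp add: integral_circle_powi)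
qed

lemma fourier_coeff_monomial:
  fixes x :: "'h::{chilbert_space,second_countable_topology}"
  shows "fourier_coeff (monomial_L2 m x) n = (if m = n then x else 0)"
  by (rule cinner_eqI) (simp add: cinner_monomial_L2[symmetric] cinner_monomial_monomial)

lemma monomial_L2_in_H2: "n \<ge> 0 \<Longrightarrow> monomial_L2 n x \<in> H2"
  by (simp add: H2_def fourier_coeff_monomial)

lemma monomial_L2_eq_iff:
  fixes x y :: "'h::{chilbert_space,second_countable_topology}"
  shows "monomial_L2 n x = monomial_L2 n y \<longleftrightarrow> x = y"
  by (metis fourier_coeff_monomial)

lemma monomial_L2_add:
  fixes x y :: "'h::{complex_inner,second_countable_topology}"
  shows "monomial_L2 n (x + y) = monomial_L2 n x + monomial_L2 n y"
proof (rule L2_eqI)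
  have "AE z in circle_measure. rep_L2 (monomial_L2 n x + monomial_L2 n y) z
      = rep_L2 (monomial_L2 n x) z + rep_L2 (monomial_L2 n y) z"
    unfolding plus_L2_def
    by (simp add: rep_abs_L2 square_integrable_add square_integrable_rep_L2)
  with AE_monomial_L2[of n "x + y"] AE_monomial_L2[of n x] AE_monomial_L2[of n y]
  show "AE z in circle_measure. rep_L2 (monomial_L2 n (x + y)) z
      = rep_L2 (monomial_L2 n x + monomial_L2 n y) z"
    by eventually_elim (simp add: scaleC_add_right)
qed

lemma monomial_L2_scaleC:
  fixes x :: "'h::{complex_inner,second_countable_topology}"
  shows "monomial_L2 n (a *\<^sub>C x) = a *\<^sub>C monomial_L2 n x"
proof (rule L2_eqI)
  have "AE z in circle_measure. rep_L2 (a *\<^sub>C monomial_L2 n x) z = a *\<^sub>C rep_L2 (monomial_L2 n x) z"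
    unfolding scaleC_L2_def
    by (simp add: rep_abs_L2 square_integrable_scaleC square_integrable_rep_L2)
  with AE_monomial_L2[of n "a *\<^sub>C x"] AE_monomial_L2[of n x]
  show "AE z in circle_measure. rep_L2 (monomial_L2 n (a *\<^sub>C x)) z
      = rep_L2 (a *\<^sub>C monomial_L2 n x) z"
    by eventually_elim (simp add: scaleC_scaleC mult.commute)
qed

lemma M_z_monomial:
  fixes x :: "'h::{complex_inner,second_countable_topology}"
  shows "M_z (monomial_L2 n x) = monomial_L2 (n + 1) x"
proof (rule L2_eqI)
  have "AE z in circle_measure. cmod z = 1"
    by (intro AE_I2 circle_spaceD)
  with AE_M_z[of "monomial_L2 n x"] AE_monomial_L2[of n x] AE_monomial_L2[of "n + 1" x]
  show "AE z in circle_measure. rep_L2 (M_z (monomial_L2 n x)) z = rep_L2 (monomial_L2 (n + 1) x) z"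
  proof eventually_elim
    case (elim z)
    then show ?case
      using powi_mult_circle[of z 1 n] by (simp add: scaleC_scaleC add.commute)
  qed
qed

lemma cinner_M_z:
  fixes f g :: "'h::{complex_inner,second_countable_topology} L2"
  shows "cinner (M_z f) (M_z g) = cinner f g"
proof -
  have id: "(\<lambda>z. z) \<in> borel_measurable circle_measure"
    by (intro borel_measurable_circle_continuous_on continuous_intros)
  have "cinner (M_z f) (M_z g)
      = (LINT z|circle_measure. cinner (z *\<^sub>C rep_L2 f z) (z *\<^sub>C rep_L2 g z))"
    by (intro cinner_L2_AE AE_M_z borel_measurable_scaleC id) auto
  also have "\<dots> = cinner f g"
    unfolding cinner_L2.rep_eq
  proof (intro Bochner_Integration.integral_cong refl)
    fix z assume "z \<in> space circle_measure"
    then have "cnj z * z = 1"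
      using complex_norm_square[of z] circle_spaceD by (simp add: mult.commute)
    then show "cinner (z *\<^sub>C rep_L2 f z) (z *\<^sub>C rep_L2 g z) = cinner (rep_L2 f z) (rep_L2 g z)"
      by (simp add: cinner_scaleC_left cinner_scaleC_right flip: mult.assoc)
  qed
  finally show ?thesis .
qed

lemma fourier_coeff_M_z:
  fixes f :: "'h::{chilbert_space,second_countable_topology} L2"
  shows "fourier_coeff (M_z f) (n + 1) = fourier_coeff f n"
  by (rule cinner_eqI)
    (simp add: cinner_monomial_L2[symmetric] M_z_monomial[symmetric] cinner_M_z)

lemma M_z_inject:
  fixes f g :: "'h::{chilbert_space,second_countable_topology} L2"
  assumes "M_z f = M_z g"
  shows "f = g"
  using assms fourier_coeff_M_z by (metis L2_eqI_fourier_coeff)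


section \<open>Conjugations\<close>

lemma conjugationD:
  assumes "conjugation C"
  shows "C (x + y) = C x + C y" "C (a *\<^sub>C x) = cnj a *\<^sub>C C x" "C (C x) = x"
    "cinner (C x) (C y) = cinner y x"
  using assms by (auto simp: conjugation_def)

text \<open>Replacing \<open>y\<close> by \<open>C (C y)\<close>: this is the form of symmetry that moves a conjugation from one argument
  to the other.\<close>

lemma conjugation_cinner_swap:
  assumes "conjugation C"
  shows "cinner (C x) y = cinner (C y) x"
  using conjugationD(3,4)[OF assms] by metis

lemma bounded_clinear_conjugation_comp:
  assumes V: "conjugation V" and J: "conjugation J"
  shows "bounded_clinear (V \<circ> J)"
proof -
  have "bounded_linear (V \<circ> J)"
    by (intro bounded_linear_intro[where K = 1])
      (auto simp: conjugationD[OF V] conjugationD[OF J] scaleR_scaleC norm_conjugation[OF V]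
        norm_conjugation[OF J])
  then show ?thesis
    by (simp add: bounded_clinear_def conjugationD[OF V] conjugationD[OF J])
qed

lemma cadjoint_eqI:
  assumes "\<And>x y. cinner (A x) y = cinner x (B y)"
  shows "cadjoint A = B"
proof -
  have "\<forall>x y. cinner (A x) y = cinner x (cadjoint A y)"
    unfolding cadjoint_def by (rule someI[of _ B]) (simp add: assms)
  then have "cinner x (cadjoint A y) = cinner x (B y)" for x y
    by (simp add: assms)
  then have "cinner (cadjoint A y) x = cinner (B y) x" for x y
    by (subst (1 2) cinner_commute) simp
  then show ?thesis
    by (intro ext cinner_eqI)
qed

text \<open>Moving first \<open>V\<close> and then \<open>J\<close> to the other side conjugates the inner product twice. The
  adjoint is thus the inverse, and conjugating \<open>V \<circ> J\<close> by \<open>J\<close> yields it as well.\<close>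

lemma cadjoint_conjugation_comp:
  assumes V: "conjugation V" and J: "conjugation J"
  shows "cadjoint (V \<circ> J) = J \<circ> V"
proof (rule cadjoint_eqI)
  fix x y
  have "cinner ((V \<circ> J) x) y = cinner (V y) (J x)"
    by (simp add: conjugation_cinner_swap[OF V])
  also have "\<dots> = cnj (cinner (J x) (V y))"
    by (rule cinner_commute)
  also have "cinner (J x) (V y) = cinner ((J \<circ> V) y) x"
    by (simp add: conjugation_cinner_swap[OF J])
  also have "cnj \<dots> = cinner x ((J \<circ> V) y)"
    by (rule cinner_commute[symmetric])
  finally show "cinner ((V \<circ> J) x) y = cinner x ((J \<circ> V) y)" .
qed

lemma unitary_conjugation_comp:
  assumes "conjugation V" "conjugation J"
  shows "unitary_op (V \<circ> J)"
  using bounded_clinear_conjugation_comp[OF assms]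
  by (simp add: unitary_op_def cadjoint_conjugation_comp[OF assms] fun_eq_iff
      conjugationD(3)[OF assms(1)] conjugationD(3)[OF assms(2)])

lemma C_symmetric_conjugation_comp:
  assumes "conjugation V" "conjugation J"
  shows "C_symmetric J (V \<circ> J)"
  using bounded_clinear_conjugation_comp[OF assms]
  by (simp add: C_symmetric_def cadjoint_conjugation_comp[OF assms] fun_eq_iff
      conjugationD(3)[OF assms(2)])

lemma AE_circle_cnj:
  assumes "AE z in circle_measure. P z"
  shows "AE z in circle_measure. P (cnj z)"
  by (rule AE_distrD[OF measurable_cnj_circle]) (simp only: distr_circle_measure_cnj assms)

text \<open>\<open>J_star J\<close> and the multiplication by \<open>V \<circ> J\<close> act on values by \<open>J\<close> and \<open>V \<circ> J\<close>; since the
  multiplier is constant, the reflection in \<open>J_star\<close> does not affect it, and the two copies of \<open>J\<close>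
  cancel. The same holds for the product in the other order.\<close>

lemma mult_op_comp_J_star:
  fixes V J :: "'h::{complex_inner,second_countable_topology} \<Rightarrow> 'h"
  assumes V: "conjugation V" and J: "conjugation J"
  shows "mult_op (\<lambda>z. V \<circ> J) \<circ> J_star J = J_star V"
proof (intro ext L2_eqI)
  fix f
  have "bounded_linear (V \<circ> J)"
    using bounded_clinear_conjugation_comp[OF V J] by (simp add: bounded_clinear_def)
  from AE_mult_op_const[OF this, of "J_star J f"] AE_J_star[OF J, of f] AE_J_star[OF V, of f]
  show "AE z in circle_measure.
      rep_L2 ((mult_op (\<lambda>z. V \<circ> J) \<circ> J_star J) f) z = rep_L2 (J_star V f) z"
    by eventually_elim (simp add: conjugationD(3)[OF J])
qed

lemma J_star_comp_mult_op:
  fixes V J :: "'h::{complex_inner,second_countable_topology} \<Rightarrow> 'h"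
  assumes V: "conjugation V" and J: "conjugation J"
  shows "J_star J \<circ> mult_op (\<lambda>z. J \<circ> V) = J_star V"
proof (intro ext L2_eqI)
  fix f
  have "bounded_linear (J \<circ> V)"
    using bounded_clinear_conjugation_comp[OF J V] by (simp add: bounded_clinear_def)
  from AE_circle_cnj[OF AE_mult_op_const[OF this, of f]]
    AE_J_star[OF J, of "mult_op (\<lambda>z. J \<circ> V) f"] AE_J_star[OF V, of f]
  show "AE z in circle_measure.
      rep_L2 ((J_star J \<circ> mult_op (\<lambda>z. J \<circ> V)) f) z = rep_L2 (J_star V f) z"
    by eventually_elim (simp add: conjugationD(3)[OF J])
qed

text \<open>Weakly, \<open>J_star V\<close> maps \<open>y e\<^sub>n\<close> to \<open>V y e\<^sub>n\<close>: the antilinear \<open>V\<close> turns \<open>z\<^sup>n\<close> into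
  \<open>(cnj z)\<^sup>n\<close>, and the reflection of the circle, which preserves the measure, restores \<open>z\<^sup>n\<close>.\<close>

lemma cinner_J_star_monomial:
  fixes V :: "'h::{complex_inner,second_countable_topology} \<Rightarrow> 'h"
  assumes V: "conjugation V"
  shows "cinner (J_star V f) (monomial_L2 n y) = cinner (monomial_L2 n (V y)) f"
proof -
  note [measurable] = measurable_cnj_circle
  have "bounded_linear V"
    using V by (intro bounded_linear_intro[where K = 1])
      (auto simp: norm_conjugation scaleR_scaleC conjugation_def)
  then have [measurable]: "V \<in> borel_measurable borel"
    by (intro borel_measurable_continuous_onI linear_continuous_on)
  have meas: "(\<lambda>z. cinner ((z powi n) *\<^sub>C V y) (rep_L2 f z)) \<in> borel_measurable circle_measure"
    by (intro borel_measurable_cinner borel_measurable_monomial borel_measurable_rep_L2)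
  have "cinner (J_star V f) (monomial_L2 n y)
      = (LINT z|circle_measure. cinner (V (rep_L2 f (cnj z))) ((z powi n) *\<^sub>C y))"
    by (intro cinner_L2_AE AE_J_star V AE_monomial_L2 borel_measurable_monomial) measurable
  also have "\<dots> = (LINT z|circle_measure. cinner ((cnj z powi n) *\<^sub>C V y) (rep_L2 f (cnj z)))"
    by (subst conjugation_cinner_swap[OF V]) (simp add: conjugationD(2)[OF V])
  also have "\<dots> = (LINT z|distr circle_measure circle_measure cnj.
      cinner ((z powi n) *\<^sub>C V y) (rep_L2 f z))"
    by (rule integral_distr[OF measurable_cnj_circle meas, symmetric])
  also have "\<dots> = cinner (monomial_L2 n (V y)) f"
    unfolding distr_circle_measure_cnj
    by (intro cinner_L2_AE[symmetric] AE_monomial_L2 borel_measurable_monomial) auto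
  finally show ?thesis .
qed


section \<open>Conjugations that commute with the shift and preserve the Hardy space\<close>

context
  fixes C :: "'h::{chilbert_space,second_countable_topology} L2 \<Rightarrow> 'h L2"
  assumes C: "conjugation C" and shift: "\<And>f. C (M_z f) = M_z (C f)"
begin

text \<open>The coefficients of negative order vanish because the image lies in \<open>H2\<close>. For \<open>n > 0\<close>, the
  symmetry of \<open>C\<close> turns the coefficient of order \<open>n\<close> into the inner product of a constant with
  \<open>C (y e\<^sub>n) = M_z (C (y e\<^bsub>n-1\<^esub>))\<close>, and the constant coefficient of a shifted element of \<open>H2\<close> is its
  coefficient of order \<open>-1\<close>, that is, zero.\<close>

lemma conjugation_constant_is_constant:
  assumes H2: "C ` H2 \<subseteq> H2"
  shows "C (monomial_L2 0 x) = monomial_L2 0 (fourier_coeff (C (monomial_L2 0 x)) 0)"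
proof (rule L2_eqI_fourier_coeff)
  fix n :: int
  have hardy: "C (monomial_L2 k y) \<in> H2" if "k \<ge> 0" for k y
    using H2 monomial_L2_in_H2[OF that] by blast
  have "fourier_coeff (C (monomial_L2 0 x)) n = 0" if "n > 0"
  proof (rule cinner_eqI)
    fix y
    have "cinner (fourier_coeff (C (monomial_L2 0 x)) n) y = cinner (C (monomial_L2 n y)) (monomial_L2 0 x)"
      by (simp add: cinner_monomial_L2[symmetric] conjugation_cinner_swap[OF C])
    also have "C (monomial_L2 n y) = M_z (C (monomial_L2 (n - 1) y))"
      using M_z_monomial[of "n - 1" y] by (simp add: shift[symmetric])
    also have "cinner \<dots> (monomial_L2 0 x) = cinner (fourier_coeff (C (monomial_L2 (n - 1) y)) (- 1)) x"
      using fourier_coeff_M_z[of "C (monomial_L2 (n - 1) y)" "- 1"] by (simp add: cinner_monomial_L2)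
    also have "fourier_coeff (C (monomial_L2 (n - 1) y)) (- 1) = 0"
      using hardy[of "n - 1" y] that by (simp add: H2_def)
    finally show "cinner (fourier_coeff (C (monomial_L2 0 x)) n) y = cinner 0 y"
      by simp
  qed
  moreover have "fourier_coeff (C (monomial_L2 0 x)) n = 0" if "n < 0"
    using hardy[of 0 x] that by (simp add: H2_def)
  ultimately show "fourier_coeff (C (monomial_L2 0 x)) n
      = fourier_coeff (monomial_L2 0 (fourier_coeff (C (monomial_L2 0 x)) 0)) n"
    by (cases n "0 :: int" rule: linorder_cases) (auto simp: fourier_coeff_monomial)
qed

text \<open>Upwards by commutation with the shift, downwards because the shift is also injective.\<close>

lemma conjugation_monomial:
  assumes "C (monomial_L2 0 x) = monomial_L2 0 v"
  shows "C (monomial_L2 n x) = monomial_L2 n v"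
proof (induction n rule: int_induct[where k = 0])
  case base
  show ?case
    by (rule assms)
next
  case (step1 i)
  then show ?case
    using shift[of "monomial_L2 i x"] by (simp add: M_z_monomial)
next
  case (step2 i)
  have "M_z (C (monomial_L2 (i - 1) x)) = M_z (monomial_L2 (i - 1) v)"
    using step2 by (simp add: shift[symmetric] M_z_monomial)
  then show ?case
    by (rule M_z_inject)
qed

lemma conjugation_on_constants:
  assumes V: "\<And>x. C (monomial_L2 0 x) = monomial_L2 0 (V x)"
  shows "conjugation V"
  unfolding conjugation_def
proof (intro conjI allI)
  fix x y a
  have "monomial_L2 0 (V (x + y)) = monomial_L2 0 (V x + V y)"
    by (simp add: V[symmetric] monomial_L2_add conjugationD[OF C])
  then show "V (x + y) = V x + V y"
    by (simp add: monomial_L2_eq_iff)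
  have "monomial_L2 0 (V (a *\<^sub>C x)) = monomial_L2 0 (cnj a *\<^sub>C V x)"
    by (simp add: V[symmetric] monomial_L2_scaleC conjugationD[OF C])
  then show "V (a *\<^sub>C x) = cnj a *\<^sub>C V x"
    by (simp add: monomial_L2_eq_iff)
  have "monomial_L2 0 (V (V x)) = monomial_L2 0 x"
    by (simp add: V[symmetric] conjugationD[OF C])
  then show "V (V x) = x"
    by (simp add: monomial_L2_eq_iff)
  have "cinner (V x) (V y) = cinner (C (monomial_L2 0 x)) (C (monomial_L2 0 y))"
    by (simp add: V cinner_monomial_monomial)
  then show "cinner (V x) (V y) = cinner y x"
    by (simp add: conjugationD[OF C] cinner_monomial_monomial)
qed

lemma conjugation_eq_J_star:
  assumes V: "\<And>x. C (monomial_L2 0 x) = monomial_L2 0 (V x)"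
  shows "C = J_star V"
proof (rule ext, rule L2_eqI_fourier_coeff, rule cinner_eqI)
  fix f :: "'h L2" and n y
  have V_conj: "conjugation V"
    by (rule conjugation_on_constants[OF V])
  have "cinner (C f) (monomial_L2 n y) = cinner (C (monomial_L2 n y)) f"
    by (rule conjugation_cinner_swap[OF C])
  also have "C (monomial_L2 n y) = monomial_L2 n (V y)"
    by (rule conjugation_monomial[OF V])
  also have "cinner \<dots> f = cinner (J_star V f) (monomial_L2 n y)"
    by (rule cinner_J_star_monomial[OF V_conj, symmetric])
  finally show "cinner (fourier_coeff (C f) n) y = cinner (fourier_coeff (J_star V f) n) y"
    by (simp add: cinner_monomial_L2)
qed

end

theorem theorem5p1:
  fixes J :: "'h::{chilbert_space,second_countable_topology} \<Rightarrow> 'h"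
    and C :: "'h L2 \<Rightarrow> 'h L2"
  assumes "conjugation J"
    and "conjugation C"
    and "C \<circ> M_z = M_z \<circ> C"
    and "C ` H2 \<subseteq> H2"
  shows "\<exists>U\<^sub>0 :: 'h \<Rightarrow> 'h. unitary_op U\<^sub>0 \<and> C_symmetric J U\<^sub>0 \<and>
           (let U = (\<lambda>z. U\<^sub>0) in
              C = mult_op U \<circ> J_star J \<and> C = J_star J \<circ> mult_op (fun_adjoint U))"
proof -
  have shift: "C (M_z f) = M_z (C f)" for f
    using fun_cong[OF assms(3), of f] by (simp only: comp_apply)
  define V where "V x = fourier_coeff (C (monomial_L2 0 x)) 0" for x
  have on_const: "C (monomial_L2 0 x) = monomial_L2 0 (V x)" for x
    unfolding V_def by (rule conjugation_constant_is_constant[OF assms(2) shift assms(4)])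
  have V: "conjugation V"
    by (rule conjugation_on_constants[OF assms(2) shift on_const])
  have "C = J_star V"
    by (rule conjugation_eq_J_star[OF assms(2) shift on_const])
  then have "C = mult_op (\<lambda>z. V \<circ> J) \<circ> J_star J
      \<and> C = J_star J \<circ> mult_op (fun_adjoint (\<lambda>z. V \<circ> J))"
    by (simp only: mult_op_comp_J_star[OF V assms(1)] J_star_comp_mult_op[OF V assms(1)]
        fun_adjoint_def cadjoint_conjugation_comp[OF V assms(1)])
  then show ?thesis
    using unitary_conjugation_comp[OF V assms(1)] C_symmetric_conjugation_comp[OF V assms(1)]
    unfolding Let_def by blast
qed

end
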